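(* For every $n\ge1$ there exists a bijection between the set of $2\times n$ Nurikabe grids and the set of strings appearing in the list $\mathbb{S}(n)$ (defined in the context).
   Context: A $2\times n$ Nurikabe grid is a black/white coloring of the cells of a $2\times n$ grid such that the black cells are edge-connected (possibly empty) and no $2\times 2$ subgrid is entirely black. The list $\mathbb{S}(n)$ of strings over $\{0,1,2,3\}$ of length $n$ is defined as follows. Set $\mathbb{S}(1)=\mathrm{core}(1)=0,1,2,3$. For $n\ge2$, set $\mathbb{S}(n)=0\cdot\mathbb{S}(n-1),\ \mathrm{core}(n)[1:]$, where $$\mathrm{core}(n)=03^{n-1},\ 1\cdot\overleftarrow{\mathrm{core}(n-1)},\ 2\cdot\mathrm{core}(n-1),\ 3^n.$$ Here $d\cdot L$ prefixes digit $d$ to every string of list $L$, $\overleftarrow{L}$ is the reversed list, commas denote concatenation, exponents denote repetition, and $L[1:]$ is $L$ with its first element removed. The strings of $\mathbb{S}(n)$ are exactly the states on the shortest solution of a Ziggu puzzle with $n$ digits. *)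

theory Defs
  imports Main "HOL-Library.FuncSet"
begin

type_synonym cell = "nat \<times> nat"

datatype colour = Black | White

text \<open>A cell is a pair (row, column), both counted from 0.\<close>

definition grid_cells :: "nat \<Rightarrow> cell set" where
  "grid_cells n = {..<2} \<times> {..<n}"

definition edge_adjacent :: "cell \<Rightarrow> cell \<Rightarrow> bool" where
  "edge_adjacent p q \<longleftrightarrow>
     (fst p = fst q \<and> (snd q = Suc (snd p) \<or> snd p = Suc (snd q))) \<or>
     (snd p = snd q \<and> (fst q = Suc (fst p) \<or> fst p = Suc (fst q)))"

definition edge_connected :: "cell set \<Rightarrow> bool" where
  "edge_connected B \<longleftrightarrow>
     (\<forall>p\<in>B. \<forall>q\<in>B. (p, q) \<in> {(a, b). a \<in> B \<and> b \<in> B \<and> edge_adjacent a b}\<^sup>*)"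

definition black_cells :: "nat \<Rightarrow> (cell \<Rightarrow> colour) \<Rightarrow> cell set" where
  "black_cells n f = {p \<in> grid_cells n. f p = Black}"

text \<open>The extensional function space gives exactly one function for each colouring of the
  \<open>2 \<times> n\<close> cells. A \<open>2 \<times> 2\<close> block of black cells automatically lies inside the grid.\<close>

definition nurikabe_grids :: "nat \<Rightarrow> (cell \<Rightarrow> colour) set" where
  "nurikabe_grids n =
     {f \<in> grid_cells n \<rightarrow>\<^sub>E UNIV.
        edge_connected (black_cells n f) \<and>
        \<not> (\<exists>i j. {i, Suc i} \<times> {j, Suc j} \<subseteq> black_cells n f)}"

text \<open>Strings are lists of digits. The values at length 0 are not part of the mathematical
  definition; they only make the functions total.\<close>

fun ziggu_core :: "nat \<Rightarrow> nat list list" where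
  "ziggu_core 0 = []"
| "ziggu_core (Suc 0) = [[0], [1], [2], [3]]"
| "ziggu_core (Suc (Suc m)) =
     [0 # replicate (Suc m) 3]
     @ map ((#) 1) (rev (ziggu_core (Suc m)))
     @ map ((#) 2) (ziggu_core (Suc m))
     @ [replicate (Suc (Suc m)) 3]"

fun ziggu_strings :: "nat \<Rightarrow> nat list list" where
  "ziggu_strings 0 = []"
| "ziggu_strings (Suc 0) = ziggu_core 1"
| "ziggu_strings (Suc (Suc m)) =
     map ((#) 0) (ziggu_strings (Suc m)) @ tl (ziggu_core (Suc (Suc m)))"

end

theory Submission
  imports Defs
begin

text \<open>Both sets are finite, so it suffices to compare their cardinalities. A set of black cells in
  two rows is Nurikabe iff any two neighbouring columns share exactly one black row whenever there
  are black cells on both sides of the line between them: at least one by connectedness, at most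
  one for lack of a black block. A nonempty column has exactly two successors of this kind (a single row is kept or
  completed, a full column loses either row), hence \<open>2\<^sup>m\<^sup>+\<^sup>1 - 1\<close> continuations by \<open>m\<close> columns. So the
  number of grids grows by \<open>3 (2\<^sup>m\<^sup>+\<^sup>1 - 1)\<close> from width \<open>m\<close> to \<open>m + 1\<close>: the first column is empty, or
  one of three nonempty ones. This is also the length of \<open>core(m + 1)[1:]\<close>.\<close>

subsection \<open>Connectedness and columns\<close>

definition adjacency :: "cell set \<Rightarrow> (cell \<times> cell) set" where
  "adjacency B = {(p, q). p \<in> B \<and> q \<in> B \<and> edge_adjacent p q}"

definition column :: "cell set \<Rightarrow> nat \<Rightarrow> nat set" where
  "column B j = {r. (r, j) \<in> B}"

definition straddles :: "cell set \<Rightarrow> nat \<Rightarrow> bool" where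
  "straddles B j \<longleftrightarrow> (\<exists>i\<le>j. column B i \<noteq> {}) \<and> (\<exists>k>j. column B k \<noteq> {})"

lemma mem_column_iff [simp]: "r \<in> column B j \<longleftrightarrow> (r, j) \<in> B"
  by (simp add: column_def)

lemma edge_connected_iff_adjacency:
  "edge_connected B \<longleftrightarrow> (\<forall>p\<in>B. \<forall>q\<in>B. (p, q) \<in> (adjacency B)\<^sup>*)"
  by (simp add: edge_connected_def adjacency_def)

lemma sym_adjacency: "sym (adjacency B)"
  by (auto simp: sym_def adjacency_def edge_adjacent_def)

lemma adjacency_mono: "A \<subseteq> B \<Longrightarrow> adjacency A \<subseteq> adjacency B"
  by (auto simp: adjacency_def)

lemma straddles_if_common_row:
  "column B j \<inter> column B (Suc j) \<noteq> {} \<Longrightarrow> straddles B j"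
  unfolding straddles_def by blast

lemma adjacency_rtrancl_imp_common_row:
  assumes "(p, q) \<in> (adjacency B)\<^sup>*" "snd p \<le> j" "j < snd q"
  shows "column B j \<inter> column B (Suc j) \<noteq> {}"
  using assms
proof (induction rule: rtrancl_induct)
  case (step q q')
  show ?case
  proof (cases "j < snd q")
    case False
    with step have "snd q = j" "q' = (fst q, Suc j)" "q \<in> B" "q' \<in> B"
      by (auto simp: adjacency_def edge_adjacent_def prod_eq_iff)
    then have "fst q \<in> column B j \<inter> column B (Suc j)"
      by auto
    then show ?thesis by blast
  qed (use step in blast)
qed simp

lemma same_column_imp_adjacency_rtrancl:
  assumes "edge_connected (B \<inter> UNIV \<times> {j})" "p \<in> B" "q \<in> B" "snd p = j" "snd q = j"
  shows "(p, q) \<in> (adjacency B)\<^sup>*"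
proof -
  have "(p, q) \<in> (adjacency (B \<inter> UNIV \<times> {j}))\<^sup>*"
    using assms by (simp add: edge_connected_iff_adjacency mem_Times_iff)
  then show ?thesis
    using rtrancl_mono[OF adjacency_mono] by blast
qed

lemma common_rows_imp_adjacency_rtrancl:
  assumes columns: "\<And>j. edge_connected (B \<inter> UNIV \<times> {j})"
    and common: "\<And>j. straddles B j \<Longrightarrow> column B j \<inter> column B (Suc j) \<noteq> {}"
    and "p \<in> B" "q \<in> B" "snd q = snd p + k"
  shows "(p, q) \<in> (adjacency B)\<^sup>*"
  using assms(3-)
proof (induction k arbitrary: p)
  case 0
  then show ?case
    by (simp add: same_column_imp_adjacency_rtrancl[OF columns])
next
  case (Suc k)
  have "fst p \<in> column B (snd p)" "fst q \<in> column B (snd q)" "snd p < snd q"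
    using Suc.prems by (cases q; simp)+
  then have "straddles B (snd p)"
    unfolding straddles_def by blast
  from common[OF this] obtain r where r: "(r, snd p) \<in> B" "(r, Suc (snd p)) \<in> B"
    by auto
  have "(p, (r, snd p)) \<in> (adjacency B)\<^sup>*"
    using Suc.prems r by (simp add: same_column_imp_adjacency_rtrancl[OF columns])
  also have "((r, snd p), (r, Suc (snd p))) \<in> adjacency B"
    using r by (simp add: adjacency_def edge_adjacent_def)
  also have "((r, Suc (snd p)), q) \<in> (adjacency B)\<^sup>*"
    using Suc.prems r by (simp add: Suc.IH)
  finally show ?case .
qed

lemma edge_connected_iff_common_rows:
  assumes columns: "\<And>j. edge_connected (B \<inter> UNIV \<times> {j})"
  shows "edge_connected B \<longleftrightarrow> (\<forall>j. straddles B j \<longrightarrow> column B j \<inter> column B (Suc j) \<noteq> {})"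
proof
  assume "edge_connected B"
  then show "\<forall>j. straddles B j \<longrightarrow> column B j \<inter> column B (Suc j) \<noteq> {}"
    unfolding edge_connected_iff_adjacency straddles_def
    by (fastforce dest: adjacency_rtrancl_imp_common_row)
next
  assume common: "\<forall>j. straddles B j \<longrightarrow> column B j \<inter> column B (Suc j) \<noteq> {}"
  have rightwards: "(p, q) \<in> (adjacency B)\<^sup>*" if "p \<in> B" "q \<in> B" "snd p \<le> snd q" for p q
    using common_rows_imp_adjacency_rtrancl[OF columns, of p q "snd q - snd p"] common that by simp
  show "edge_connected B"
    unfolding edge_connected_iff_adjacency
    using rightwards symD[OF sym_rtrancl[OF sym_adjacency]] by (meson nat_le_linear)
qed

lemma edge_connected_column_if_two_rows:
  assumes "B \<subseteq> {..<2} \<times> UNIV"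
  shows "edge_connected (B \<inter> UNIV \<times> {j})"
  unfolding edge_connected_iff_adjacency
proof (intro ballI)
  fix p q assume pq: "p \<in> B \<inter> UNIV \<times> {j}" "q \<in> B \<inter> UNIV \<times> {j}"
  then have "snd p = snd q" "fst p < 2" "fst q < 2"
    using assms by auto
  then have "p = q \<or> edge_adjacent p q"
    by (auto simp: edge_adjacent_def prod_eq_iff less_2_cases_iff)
  with pq show "(p, q) \<in> (adjacency (B \<inter> UNIV \<times> {j}))\<^sup>*"
    by (auto simp: adjacency_def)
qed

lemma consecutive_pair_in_two_iff:
  assumes "X \<subseteq> {..<2}"
  shows "(\<exists>i. {i, Suc i} \<subseteq> X) \<longleftrightarrow> 1 < card X"
proof -
  have "X \<in> Pow {0, 1}"
    using assms by (auto simp: less_2_cases_iff)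
  then show ?thesis
    by (auto simp: Pow_insert)
qed

lemma nurikabe_iff_unique_common_rows:
  assumes rows: "B \<subseteq> {..<2} \<times> UNIV"
  shows "edge_connected B \<and> \<not> (\<exists>i j. {i, Suc i} \<times> {j, Suc j} \<subseteq> B) \<longleftrightarrow>
    (\<forall>j. straddles B j \<longrightarrow> card (column B j \<inter> column B (Suc j)) = 1)"
proof -
  let ?common = "\<lambda>j. column B j \<inter> column B (Suc j)"
  have sub: "?common j \<subseteq> {..<2}" for j
    using rows by auto
  have "{i, Suc i} \<times> {j, Suc j} \<subseteq> B \<longleftrightarrow> {i, Suc i} \<subseteq> ?common j" for i j
    by auto
  then have "(\<exists>i j. {i, Suc i} \<times> {j, Suc j} \<subseteq> B) \<longleftrightarrow> (\<exists>j. 1 < card (?common j))"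
    using consecutive_pair_in_two_iff[OF sub] by metis
  moreover have "card (?common j) = 1 \<longleftrightarrow> ?common j \<noteq> {} \<and> \<not> 1 < card (?common j)" for j
    using card_gt_0_iff[of "?common j"] finite_subset[OF sub[of j]] by auto
  moreover have "straddles B j" if "1 < card (?common j)" for j
    using that by (intro straddles_if_common_row) auto
  ultimately show ?thesis
    unfolding edge_connected_iff_common_rows[OF edge_connected_column_if_two_rows[OF rows]]
    by blast
qed

subsection \<open>Grids as words of columns\<close>

definition nurikabe_word :: "'a set list \<Rightarrow> bool" where
  "nurikabe_word w \<longleftrightarrow>
     (\<forall>j. (\<exists>c\<in>set (take (Suc j) w). c \<noteq> {}) \<and> (\<exists>c\<in>set (drop (Suc j) w). c \<noteq> {}) \<longrightarrow>
        card (w ! j \<inter> w ! Suc j) = 1)"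

definition nurikabe_words :: "nat \<Rightarrow> nat set list set" where
  "nurikabe_words n = {w. set w \<subseteq> Pow {..<2} \<and> length w = n \<and> nurikabe_word w}"

definition black_columns :: "nat \<Rightarrow> (cell \<Rightarrow> colour) \<Rightarrow> nat set list" where
  "black_columns n f = map (column (black_cells n f)) [0..<n]"

definition colouring :: "nat \<Rightarrow> nat set list \<Rightarrow> cell \<Rightarrow> colour" where
  "colouring n w = (\<lambda>(r, j)\<in>grid_cells n. if r \<in> w ! j then Black else White)"

lemma bij_betw_black_columns:
  "bij_betw (black_columns n) (grid_cells n \<rightarrow>\<^sub>E UNIV) {w. set w \<subseteq> Pow {..<2} \<and> length w = n}"
proof (rule bij_betw_byWitness[where f' = "colouring n"])
  show "\<forall>f\<in>grid_cells n \<rightarrow>\<^sub>E UNIV. colouring n (black_columns n f) = f"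
  proof
    fix f :: "cell \<Rightarrow> colour" assume f: "f \<in> grid_cells n \<rightarrow>\<^sub>E UNIV"
    have "colouring n (black_columns n f) p = f p" if "p \<in> grid_cells n" for p
      using that by (cases "f p")
        (auto simp: colouring_def black_columns_def black_cells_def grid_cells_def)
    with f show "colouring n (black_columns n f) = f"
      by (intro extensionalityI[of _ "grid_cells n"]) (auto simp: colouring_def PiE_def)
  qed
  show "\<forall>w\<in>{w. set w \<subseteq> Pow {..<2} \<and> length w = n}. black_columns n (colouring n w) = w"
  proof (intro ballI nth_equalityI)
    fix w j assume "w \<in> {w. set w \<subseteq> Pow {..<2} \<and> length w = n}"
      and "j < length (black_columns n (colouring n w))"
    then have "w ! j \<subseteq> {..<2}" "j < n"
      by (auto simp: black_columns_def dest!: nth_mem)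
    then show "black_columns n (colouring n w) ! j = w ! j"
      by (auto simp: black_columns_def colouring_def black_cells_def grid_cells_def split: if_splits)
  qed (auto simp: black_columns_def)
qed (auto simp: colouring_def black_columns_def black_cells_def grid_cells_def
    split: if_splits)

lemma nurikabe_word_columns_iff:
  assumes "B \<subseteq> UNIV \<times> {..<n}"
  shows "nurikabe_word (map (column B) [0..<n]) \<longleftrightarrow>
    (\<forall>j. straddles B j \<longrightarrow> card (column B j \<inter> column B (Suc j)) = 1)"
proof -
  let ?w = "map (column B) [0..<n]"
  have inside: "i < n" if "column B i \<noteq> {}" for i
    using assms that by (auto simp: column_def)
  have take_columns: "take (Suc j) ?w = map (column B) [0..<min (Suc j) n]" for j
    by (simp add: take_map min_def)
  have "(\<exists>c\<in>set (take (Suc j) ?w). c \<noteq> {}) \<longleftrightarrow> (\<exists>i<min (Suc j) n. column B i \<noteq> {})" for j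
    by (simp only: take_columns set_map set_upt bex_simps atLeast0LessThan) blast
  then have "(\<exists>c\<in>set (take (Suc j) ?w). c \<noteq> {}) \<longleftrightarrow> (\<exists>i\<le>j. column B i \<noteq> {})" for j
    using inside by (metis less_Suc_eq_le min_less_iff_conj)
  moreover have "(\<exists>c\<in>set (drop (Suc j) ?w). c \<noteq> {}) \<longleftrightarrow> (\<exists>k\<in>{Suc j..<n}. column B k \<noteq> {})" for j
    by (simp only: drop_map drop_upt set_map set_upt bex_simps add_0)
  then have "(\<exists>c\<in>set (drop (Suc j) ?w). c \<noteq> {}) \<longleftrightarrow> (\<exists>k>j. column B k \<noteq> {})" for j
    using inside by (metis atLeastLessThan_iff Suc_le_eq)
  ultimately have "nurikabe_word ?w \<longleftrightarrow>
      (\<forall>j. straddles B j \<longrightarrow> card (?w ! j \<inter> ?w ! Suc j) = 1)"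
    by (simp add: nurikabe_word_def straddles_def)
  moreover have "?w ! j \<inter> ?w ! Suc j = column B j \<inter> column B (Suc j)" if "straddles B j" for j
  proof -
    have "Suc j < n"
      using that inside by (fastforce simp: straddles_def)
    then show ?thesis by simp
  qed
  ultimately show ?thesis by metis
qed

lemma nurikabe_word_black_columns_iff:
  "nurikabe_word (black_columns n f) \<longleftrightarrow> edge_connected (black_cells n f) \<and>
     \<not> (\<exists>i j. {i, Suc i} \<times> {j, Suc j} \<subseteq> black_cells n f)"
proof -
  have "black_cells n f \<subseteq> UNIV \<times> {..<n}" "black_cells n f \<subseteq> {..<2} \<times> UNIV"
    by (auto simp: black_cells_def grid_cells_def)
  then show ?thesis
    by (simp only: black_columns_def nurikabe_word_columns_iff nurikabe_iff_unique_common_rows)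
qed

lemma bij_betw_nurikabe_words: "bij_betw (black_columns n) (nurikabe_grids n) (nurikabe_words n)"
  using bij_betw_Collect[OF bij_betw_black_columns,
      where Q = nurikabe_word, OF nurikabe_word_black_columns_iff]
  by (simp add: nurikabe_grids_def nurikabe_words_def conj_assoc)

subsection \<open>Counting words\<close>

lemma nurikabe_word_Nil [simp]: "nurikabe_word []"
  by (simp add: nurikabe_word_def)

lemma nurikabe_word_Cons:
  "nurikabe_word (c # w) \<longleftrightarrow>
     (c \<noteq> {} \<and> (\<exists>d\<in>set w. d \<noteq> {}) \<longrightarrow> card (c \<inter> w ! 0) = 1) \<and>
     (\<forall>j. (c \<noteq> {} \<or> (\<exists>d\<in>set (take (Suc j) w). d \<noteq> {})) \<and> (\<exists>d\<in>set (drop (Suc j) w). d \<noteq> {})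
       \<longrightarrow> card (w ! j \<inter> w ! Suc j) = 1)"
proof -
  have all_nat: "(\<forall>j. P j) \<longleftrightarrow> P 0 \<and> (\<forall>j. P (Suc j))" for P :: "nat \<Rightarrow> bool"
    by (metis not0_implies_Suc)
  show ?thesis
    unfolding nurikabe_word_def by (subst all_nat) simp
qed

lemma nurikabe_word_empty_Cons [simp]: "nurikabe_word ({} # w) \<longleftrightarrow> nurikabe_word w"
  by (simp add: nurikabe_word_Cons nurikabe_word_def[of w])

lemma nurikabe_word_Cons_empty:
  assumes "c \<noteq> {}"
  shows "nurikabe_word (c # {} # w) \<longleftrightarrow> set w \<subseteq> {{}}"
  using assms set_drop_subset by (fastforce simp: nurikabe_word_Cons[of c])

lemma nurikabe_word_Cons_nonempty:
  assumes "c \<noteq> {}" "d \<noteq> {}"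
  shows "nurikabe_word (c # d # w) \<longleftrightarrow> card (c \<inter> d) = 1 \<and> nurikabe_word (d # w)"
  using assms by (simp add: nurikabe_word_Cons[of c] nurikabe_word_def[of "d # w"])

lemma finite_nurikabe_words: "finite (nurikabe_words n)"
  by (rule finite_subset[OF _ finite_lists_length_eq[of "Pow {..<2}" n]])
    (auto simp: nurikabe_words_def)

lemma finite_tails: "finite L \<Longrightarrow> finite {w. a # w \<in> L}"
  using finite_vimageI[of L "(#) a"] by (simp add: vimage_def)

lemma card_lists_eq_sum_tails:
  assumes "finite A" "finite L" "\<And>w. w \<in> L \<Longrightarrow> w \<noteq> [] \<and> hd w \<in> A"
  shows "card L = (\<Sum>a\<in>A. card {w. a # w \<in> L})"
proof -
  have "bij_betw (\<lambda>(a, w). a # w) (SIGMA a:A. {w. a # w \<in> L}) L"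
    using assms(3) by (force simp: bij_betw_def inj_on_def neq_Nil_conv image_iff)
  then show ?thesis
    using assms(1,2) by (simp add: bij_betw_same_card[symmetric] finite_tails)
qed

lemma card_subsets_with_card_Int:
  assumes "finite R" "c \<subseteq> R"
  shows "card {d \<in> Pow R. card (c \<inter> d) = k} = (card c choose k) * 2 ^ (card R - card c)"
proof -
  have "finite c"
    using assms finite_subset by blast
  have separate: "c \<inter> (s \<union> e) = s" "(s \<union> e) - c = e" if "s \<subseteq> c" "e \<subseteq> R - c" for s e
    using that by auto
  have "bij_betw (\<lambda>d. (c \<inter> d, d - c)) {d \<in> Pow R. card (c \<inter> d) = k}
      ({s. s \<subseteq> c \<and> card s = k} \<times> Pow (R - c))"
  proof (rule bij_betw_byWitness[where f' = "\<lambda>(s, e). s \<union> e"])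
    show "(\<lambda>(s, e). s \<union> e) ` ({s. s \<subseteq> c \<and> card s = k} \<times> Pow (R - c)) \<subseteq>
        {d \<in> Pow R. card (c \<inter> d) = k}"
      using \<open>c \<subseteq> R\<close> by (clarsimp simp: separate) blast
  qed (auto simp: separate)
  then have "card {d \<in> Pow R. card (c \<inter> d) = k} =
      card ({s. s \<subseteq> c \<and> card s = k} \<times> Pow (R - c))"
    by (rule bij_betw_same_card)
  then show ?thesis
    using assms \<open>finite c\<close>
    by (simp add: card_cartesian_product n_subsets card_Pow card_Diff_subset)
qed

lemma card_columns_meeting_once:
  assumes "c \<subseteq> {..<2::nat}" "c \<noteq> {}"
  shows "card {d \<in> Pow {..<2}. card (c \<inter> d) = 1} = 2"
proof -
  have "card c \<noteq> 0" "card c \<le> 2"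
    using assms finite_subset[of c "{..<2}"] card_mono[of "{..<2}" c] by auto
  then have "card c = 1 \<or> card c = 2"
    by linarith
  then show ?thesis
    using card_subsets_with_card_Int[of "{..<2}" c 1] assms by auto
qed

lemma card_nurikabe_continuations_Suc:
  assumes c: "c \<subseteq> {..<2}" "c \<noteq> {}"
  shows "card {w. c # w \<in> nurikabe_words (Suc (Suc m))} =
    1 + (\<Sum>d \<in> {d \<in> Pow {..<2}. card (c \<inter> d) = 1}. card {w. d # w \<in> nurikabe_words (Suc m)})"
proof -
  let ?tails = "\<lambda>d. {w. c # d # w \<in> nurikabe_words (Suc (Suc m))}"
  have "finite {w. c # w \<in> nurikabe_words (Suc (Suc m))}"
    by (rule finite_tails[OF finite_nurikabe_words])
  then have "card {w. c # w \<in> nurikabe_words (Suc (Suc m))} = (\<Sum>d\<in>Pow {..<2}. card (?tails d))"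
    by (subst card_lists_eq_sum_tails[where A = "Pow {..<2}"])
      (auto simp: nurikabe_words_def length_Suc_conv)
  also have "\<dots> = card (?tails {}) + (\<Sum>d\<in>Pow {..<2} - {{}}. card (?tails d))"
    by (rule sum.remove) auto
  also have "?tails {} = {replicate m {}}"
    using c by (auto simp: nurikabe_words_def nurikabe_word_Cons_empty intro!: replicate_eqI)
  also have "(\<Sum>d\<in>Pow {..<2} - {{}}. card (?tails d)) =
      (\<Sum>d \<in> {d \<in> Pow {..<2}. card (c \<inter> d) = 1}. card {w. d # w \<in> nurikabe_words (Suc m)})"
  proof (rule sum.mono_neutral_cong_right)
    have tails: "?tails d = (if card (c \<inter> d) = 1 then {w. d # w \<in> nurikabe_words (Suc m)} else {})"
      if "d \<in> Pow {..<2} - {{}}" for d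
      using that c by (auto simp: nurikabe_words_def nurikabe_word_Cons_nonempty)
    show "\<forall>d \<in> Pow {..<2} - {{}} - {d \<in> Pow {..<2}. card (c \<inter> d) = 1}. card (?tails d) = 0"
      using tails by simp
    show "card (?tails d) = card {w. d # w \<in> nurikabe_words (Suc m)}"
      if "d \<in> {d \<in> Pow {..<2}. card (c \<inter> d) = 1}" for d
      using that tails[of d] by (cases "d = {}") simp_all
  qed auto
  finally show ?thesis by simp
qed

lemma card_nurikabe_continuations:
  assumes "c \<subseteq> {..<2}" "c \<noteq> {}"
  shows "card {w. c # w \<in> nurikabe_words (Suc m)} = 2 ^ Suc m - 1"
  using assms
proof (induction m arbitrary: c)
  case 0
  then have "{w. c # w \<in> nurikabe_words (Suc 0)} = {[]}"
    by (auto simp: nurikabe_words_def nurikabe_word_Cons)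
  then show ?case by simp
next
  case (Suc m)
  let ?successors = "{d \<in> Pow {..<2}. card (c \<inter> d) = 1}"
  have "(\<Sum>d\<in>?successors. card {w. d # w \<in> nurikabe_words (Suc m)}) =
      (\<Sum>d\<in>?successors. 2 ^ Suc m - 1)"
    by (rule sum.cong[OF refl], rule Suc.IH) auto
  also have "\<dots> = 2 * (2 ^ Suc m - 1)"
    using card_columns_meeting_once[OF Suc.prems] by simp
  finally have "card {w. c # w \<in> nurikabe_words (Suc (Suc m))} = 1 + 2 * (2 ^ Suc m - 1)"
    using card_nurikabe_continuations_Suc[OF Suc.prems] by simp
  moreover have "(1::nat) \<le> 2 ^ Suc m"
    by (rule one_le_power) simp
  ultimately show ?case
    unfolding power_Suc[of 2 "Suc m"] by linarith
qed

lemma card_nurikabe_words_0: "card (nurikabe_words 0) = 1"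
proof -
  have "nurikabe_words 0 = {[]}"
    by (auto simp: nurikabe_words_def)
  then show ?thesis by simp
qed

lemma card_nurikabe_words_Suc:
  "card (nurikabe_words (Suc m)) = card (nurikabe_words m) + 3 * (2 ^ Suc m - 1)"
proof -
  let ?tails = "\<lambda>c. {w. c # w \<in> nurikabe_words (Suc m)}"
  have "card (nurikabe_words (Suc m)) = (\<Sum>c\<in>Pow {..<2}. card (?tails c))"
    by (intro card_lists_eq_sum_tails finite_nurikabe_words)
      (auto simp: nurikabe_words_def length_Suc_conv)
  also have "\<dots> = card (?tails {}) + (\<Sum>c\<in>Pow {..<2} - {{}}. card (?tails c))"
    by (rule sum.remove) auto
  also have "?tails {} = nurikabe_words m"
    by (auto simp: nurikabe_words_def)
  also have "(\<Sum>c\<in>Pow {..<2} - {{}}. card (?tails c)) =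
      (\<Sum>c\<in>Pow {..<2::nat} - {{}}. 2 ^ Suc m - 1)"
    by (rule sum.cong) (auto simp: card_nurikabe_continuations)
  also have "\<dots> = 3 * (2 ^ Suc m - 1)"
    by (simp add: card_Diff_singleton card_Pow)
  finally show ?thesis .
qed

subsection \<open>Counting strings\<close>

lemma distinct_ziggu_core: "distinct (ziggu_core n)"
  by (induction n rule: ziggu_core.induct) (auto simp: distinct_map)

lemma distinct_ziggu_strings: "distinct (ziggu_strings n)"
  by (induction n rule: ziggu_strings.induct) (auto simp: distinct_map distinct_ziggu_core)

lemma length_ziggu_core: "length (ziggu_core (Suc m)) + 2 = 3 * 2 ^ Suc m"
  by (induction m) auto

lemma length_ziggu_strings_Suc:
  assumes "1 \<le> n"
  shows "length (ziggu_strings (Suc n)) = length (ziggu_strings n) + 3 * (2 ^ Suc n - 1)"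
proof (cases n)
  case (Suc m)
  then show ?thesis
    using length_ziggu_core[of n] by simp
qed (use assms in simp)

lemma card_nurikabe_words_eq_length_ziggu_strings:
  assumes "1 \<le> n"
  shows "card (nurikabe_words n) = length (ziggu_strings n)"
  using assms
proof (induction n rule: nat_induct_at_least)
  case base
  show ?case
    using card_nurikabe_words_Suc[of 0] by (simp add: card_nurikabe_words_0)
qed (simp add: card_nurikabe_words_Suc length_ziggu_strings_Suc del: ziggu_strings.simps)

theorem theorem11p3:
  fixes n :: nat
  assumes "n \<ge> 1"
  shows "\<exists>\<phi>. bij_betw \<phi> (nurikabe_grids n) (set (ziggu_strings n))"
proof -
  have "card (nurikabe_words n) = card (set (ziggu_strings n))"
    using card_nurikabe_words_eq_length_ziggu_strings[OF assms]
    by (simp add: distinct_card[OF distinct_ziggu_strings])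
  then obtain \<psi> where "bij_betw \<psi> (nurikabe_words n) (set (ziggu_strings n))"
    using finite_same_card_bij[OF finite_nurikabe_words finite_set] by blast
  with bij_betw_nurikabe_words show ?thesis
    by (blast intro: bij_betw_trans)
qed

end
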